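(* Let $\varphi=\varphi(x_1,x_2)$ be a real analytic (real-valued) function, and consider its Wick rotation $\psi(x_1,x_2)=\varphi(ix_1,x_2)$. Then $\psi$ is real (resp. purely imaginary) valued if and only if $\varphi$ is even (resp. odd) with respect to the $x_1$-axis, i.e. $\varphi(-x_1,x_2)=\varphi(x_1,x_2)$ (resp. $\varphi(-x_1,x_2)=-\varphi(x_1,x_2)$). Moreover, $\psi$ is then also even (resp. odd) with respect to the $x_1$-axis.
   Context: Here $x_1,x_2$ are two of the canonical coordinates of $\mathbb{E}^3$ or $\mathbb{L}^3$ (i.e. two real variables). The function $\varphi$ is defined on a (connected) domain meeting $\{x_1=0\}$ and symmetric under $x_1\mapsto-x_1$. For real $x_1$ near $0$, $\varphi(ix_1,x_2)$ denotes the value obtained by substituting $ix_1$ for $x_1$ in the Taylor expansion $\varphi(x_1,x_2)=\sum_{n\ge0}a_n(x_2)x_1^n$ near $x_1=0$ (analytic continuation); $\psi$ is considered near $x_1=0$. *)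

theory Defs
  imports "HOL-Analysis.Analysis"
begin

text \<open>
  Real analyticity in two real variables: around every point of \<open>D\<close> the function is
  the sum of a double power series.  Since \<open>has_sum\<close> is unconditional summation, the series
  converges absolutely on the box, independently of any ordering of the index pairs.
\<close>

definition real_analytic_on :: "(real \<times> real) set \<Rightarrow> (real \<times> real \<Rightarrow> real) \<Rightarrow> bool" where
  "real_analytic_on D \<phi> \<longleftrightarrow>
     (\<forall>(a, b)\<in>D. \<exists>r>0. \<exists>c :: nat \<Rightarrow> nat \<Rightarrow> real. \<forall>x y. \<bar>x - a\<bar> < r \<longrightarrow> \<bar>y - b\<bar> < r \<longrightarrow>
        ((\<lambda>(m, n). c m n * (x - a) ^ m * (y - b) ^ n) has_sum \<phi> (x, y)) UNIV)"

definition symmetric_x1 :: "(real \<times> real) set \<Rightarrow> bool" where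
  "symmetric_x1 S \<longleftrightarrow> (\<forall>(x1, x2)\<in>S. (- x1, x2) \<in> S)"

definition even_x1_on :: "(real \<times> real) set \<Rightarrow> (real \<times> real \<Rightarrow> 'a) \<Rightarrow> bool" where
  "even_x1_on S f \<longleftrightarrow> (\<forall>(x1, x2)\<in>S. f (- x1, x2) = f (x1, x2))"

definition odd_x1_on :: "(real \<times> real) set \<Rightarrow> (real \<times> real \<Rightarrow> 'a :: uminus) \<Rightarrow> bool" where
  "odd_x1_on S f \<longleftrightarrow> (\<forall>(x1, x2)\<in>S. f (- x1, x2) = - f (x1, x2))"

definition x1_zero_set :: "(real \<times> real) set" where
  "x1_zero_set = {(x1, x2). x1 = 0}"

text \<open>The coefficients \<open>a\<^sub>n(x\<^sub>2)\<close> of the Taylor expansion of \<open>\<phi>(\<cdot>, x\<^sub>2)\<close> at \<open>x\<^sub>1 = 0\<close>.\<close>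

definition taylor_x1 :: "(real \<times> real \<Rightarrow> real) \<Rightarrow> nat \<Rightarrow> real \<Rightarrow> real" where
  "taylor_x1 \<phi> n x2 = (deriv ^^ n) (\<lambda>x1. \<phi> (x1, x2)) 0 / fact n"

definition wick :: "(real \<times> real \<Rightarrow> real) \<Rightarrow> real \<times> real \<Rightarrow> complex" where
  "wick \<phi> = (\<lambda>(x1, x2). \<Sum>n. of_real (taylor_x1 \<phi> n x2) * (\<i> * of_real x1) ^ n)"

text \<open>
  The points at which the series defining \<open>wick \<phi>\<close> is meaningful.  This set is invariant
  under \<open>x\<^sub>1 \<mapsto> -x\<^sub>1\<close>; the lemma \<open>wick_domain_nhd\<close> below shows that it contains
  a symmetric open neighbourhood of the part of \<open>{x\<^sub>1 = 0}\<close> lying in \<open>D\<close>.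
\<close>

definition wick_domain :: "(real \<times> real) set \<Rightarrow> (real \<times> real \<Rightarrow> real) \<Rightarrow> (real \<times> real) set" where
  "wick_domain D \<phi> =
     {(x1, x2). (0, x2) \<in> D \<and> ereal \<bar>x1\<bar> < conv_radius (\<lambda>n. taylor_x1 \<phi> n x2)}"

lemma fps_nth_fps_expansion_real:
  fixes f :: "real \<Rightarrow> real"
  assumes "f has_fps_expansion F"
  shows "fps_nth F n = (deriv ^^ n) f 0 / fact n"
  using assms
proof (induction n arbitrary: f F)
  case 0
  then have "eval_fps F 0 = f 0"
    by (auto simp: has_fps_expansion_def dest: eventually_nhds_x_imp_x)
  then show ?case by (simp add: eval_fps_at_0)
next
  case (Suc n)
  have "fps_nth (fps_deriv F) n = (deriv ^^ n) (deriv f) 0 / fact n"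
    by (rule Suc.IH[OF has_fps_expansion_deriv[OF Suc.prems]])
  also have "(deriv ^^ n) (deriv f) = (deriv ^^ Suc n) f"
    by (simp only: funpow_Suc_right o_apply)
  finally have "of_nat (Suc n) * fps_nth F (Suc n) = (deriv ^^ Suc n) f 0 / fact n"
    by (simp del: funpow.simps)
  then show ?case by (simp add: field_simps del: funpow.simps of_nat_Suc)
qed

lemma taylor_x1_power_series:
  fixes A :: "nat \<Rightarrow> real"
  assumes r: "r > 0" and A: "\<And>x. \<bar>x\<bar> < r \<Longrightarrow> (\<lambda>m. A m * x ^ m) sums \<phi> (x, y)"
  shows "taylor_x1 \<phi> n y = A n" and "ereal r \<le> conv_radius (\<lambda>n. taylor_x1 \<phi> n y)"
proof -
  have rad: "conv_radius A \<ge> ereal r"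
  proof (rule conv_radius_geI_ex')
    fix s :: real assume "0 < s" "ereal s < ereal r"
    then show "summable (\<lambda>n. A n * of_real s ^ n)"
      using A[of s] by (auto simp: sums_iff)
  qed
  have "(\<lambda>x. \<phi> (x, y)) has_fps_expansion Abs_fps A"
    unfolding has_fps_expansion_def
  proof
    show "0 < fps_conv_radius (Abs_fps A)"
      unfolding fps_conv_radius_def using rad r
      by (simp add: order.strict_trans2[of 0 "ereal r"])
    have "eventually (\<lambda>x::real. \<bar>x\<bar> < r) (nhds 0)"
      using eventually_nhds_ball[OF r, of "0::real"] by eventually_elim (simp add: dist_norm)
    then show "\<forall>\<^sub>F z in nhds 0. eval_fps (Abs_fps A) z = \<phi> (z, y)"
      by eventually_elim (use A in \<open>auto simp: eval_fps_def sums_iff\<close>)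
  qed
  from fps_nth_fps_expansion_real[OF this] have *: "A n = taylor_x1 \<phi> n y" for n
    by (simp add: taylor_x1_def)
  then show "taylor_x1 \<phi> n y = A n" by simp
  show "ereal r \<le> conv_radius (\<lambda>n. taylor_x1 \<phi> n y)"
    using rad unfolding * by simp
qed

lemma real_analytic_on_slice:
  assumes c: "\<And>x y. \<bar>x\<bar> < r \<Longrightarrow> \<bar>y - b\<bar> < r \<Longrightarrow>
      ((\<lambda>(m, n). c m n * x ^ m * (y - b) ^ n) has_sum \<phi> (x, y)) UNIV"
    and r: "r > 0" and y: "\<bar>y - b\<bar> < r"
  obtains A :: "nat \<Rightarrow> real" where "\<And>x. \<bar>x\<bar> < r \<Longrightarrow> (\<lambda>m. A m * x ^ m) sums \<phi> (x, y)"
proof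
  fix x :: real assume x: "\<bar>x\<bar> < r"
  let ?t = "\<lambda>z m n. c m n * z ^ m * (y - b) ^ n"
  have slice: "(\<lambda>n. ?t z m n) summable_on UNIV" if "\<bar>z\<bar> < r" for z m
    using summable_on_SigmaD1[of "?t z" UNIV "\<lambda>_. UNIV" m] c[OF that y]
    by (auto simp: summable_on_def)
  have coeff: "(\<lambda>n. c m n * (y - b) ^ n) summable_on UNIV" for m
  proof -
    have "(\<lambda>n. ?t (r / 2) m n * (2 / r) ^ m) summable_on UNIV"
      using slice[of "r / 2" m] r by (intro summable_on_cmult_left) auto
    moreover have "(\<lambda>n. ?t (r / 2) m n * (2 / r) ^ m) = (\<lambda>n. c m n * (y - b) ^ n)"
      using r by (auto simp: fun_eq_iff power_divide)
    ultimately show ?thesis by simp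
  qed
  have row: "((\<lambda>n. ?t x m n) has_sum (\<Sum>\<^sub>\<infinity>n. c m n * (y - b) ^ n) * x ^ m) UNIV" for m
    using has_sum_cmult_left[OF has_sum_infsum[OF coeff[of m]], of "x ^ m"]
    by (simp add: mult_ac)
  have "((\<lambda>m. (\<Sum>\<^sub>\<infinity>n. c m n * (y - b) ^ n) * x ^ m) has_sum \<phi> (x, y)) UNIV"
    by (rule has_sum_SigmaD[where B = "\<lambda>_. UNIV" and f = "\<lambda>(m, n). ?t x m n"])
      (use c[OF x y] row in auto)
  then show "(\<lambda>m. (\<Sum>\<^sub>\<infinity>n. c m n * (y - b) ^ n) * x ^ m) sums \<phi> (x, y)"
    by (rule has_sum_imp_sums)
qed

lemma wick_domain_nhd:
  assumes D: "open D" and \<phi>: "real_analytic_on D \<phi>"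
  shows "\<exists>U. open U \<and> symmetric_x1 U \<and> D \<inter> x1_zero_set \<subseteq> U \<and> U \<subseteq> wick_domain D \<phi>"
proof -
  have ex: "\<exists>e>0. {- e<..<e} \<times> {b - e<..<b + e} \<subseteq> wick_domain D \<phi>" if b: "(0, b) \<in> D" for b
  proof -
    obtain r c where r: "r > 0" and c: "\<And>x y. \<bar>x - 0\<bar> < r \<Longrightarrow> \<bar>y - b\<bar> < r \<Longrightarrow>
        ((\<lambda>(m, n). c m n * (x - 0) ^ m * (y - b) ^ n) has_sum \<phi> (x, y)) UNIV"
      using \<phi> b unfolding real_analytic_on_def by blast
    have "open ((\<lambda>y. (0, y)) -` D)"
      using D by (intro continuous_open_vimage) (auto intro!: continuous_intros)
    then obtain d where d: "d > 0" "\<And>y. dist y b < d \<Longrightarrow> (0, y) \<in> D"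
      using b unfolding open_dist by auto
    define e where "e = min r d"
    have "(x, y) \<in> wick_domain D \<phi>" if x: "\<bar>x\<bar> < e" and y: "\<bar>y - b\<bar> < e" for x y
    proof -
      have yr: "\<bar>y - b\<bar> < r" using y by (simp add: e_def)
      obtain A where A: "\<And>x. \<bar>x\<bar> < r \<Longrightarrow> (\<lambda>m. A m * x ^ m) sums \<phi> (x, y)"
        using real_analytic_on_slice[of r b c \<phi> y] c r yr by auto
      have "ereal \<bar>x\<bar> < ereal r" using x by (simp add: e_def)
      also have "\<dots> \<le> conv_radius (\<lambda>n. taylor_x1 \<phi> n y)"
        using taylor_x1_power_series(2)[of r A \<phi> y] r A by blast
      finally show ?thesis
        using d(2)[of y] y by (simp add: wick_domain_def e_def dist_real_def)
    qed
    moreover have "e > 0" using r d by (simp add: e_def)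
    ultimately show ?thesis by (intro exI[of _ e]) (auto simp: abs_less_iff)
  qed
  define bx where "bx = (\<lambda>e b::real. {- e<..<e::real} \<times> {b - e<..<b + e})"
  define U where "U = \<Union>{bx e b | e b. e > 0 \<and> bx e b \<subseteq> wick_domain D \<phi>}"
  have "open U" unfolding U_def bx_def by (auto intro!: open_Union open_Times)
  moreover have "symmetric_x1 U"
    unfolding symmetric_x1_def
  proof clarify
    fix x1 x2 assume "(x1, x2) \<in> U"
    then obtain e b where e: "e > 0" "bx e b \<subseteq> wick_domain D \<phi>" and "(x1, x2) \<in> bx e b"
      unfolding U_def by blast
    then have "(- x1, x2) \<in> bx e b" by (auto simp: bx_def)
    with e show "(- x1, x2) \<in> U" unfolding U_def by blast
  qed
  moreover have "D \<inter> x1_zero_set \<subseteq> U"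
  proof
    fix p assume "p \<in> D \<inter> x1_zero_set"
    then obtain b where p: "p = (0, b)" "(0, b) \<in> D" by (auto simp: x1_zero_set_def)
    with ex[of b] obtain e where "e > 0" "bx e b \<subseteq> wick_domain D \<phi>"
      by (auto simp: bx_def)
    moreover have "p \<in> bx e b" using p \<open>e > 0\<close> by (simp add: bx_def)
    ultimately show "p \<in> U" unfolding U_def by blast
  qed
  moreover have "U \<subseteq> wick_domain D \<phi>" unfolding U_def by blast
  ultimately show ?thesis by blast
qed

end

theory Submission
  imports Defs "HOL-Complex_Analysis.Conformal_Mappings"
begin

text \<open>
  On its domain \<open>\<psi> = wick \<phi>\<close> satisfies \<open>cnj (\<psi>(x, y)) = \<psi>(-x, y)\<close>: the Taylor
  coefficients are real, so conjugation only replaces \<open>\<i> x\<close> by \<open>-\<i> x\<close>.  Hence \<open>\<psi>\<close> is real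
  (imaginary) valued iff it is even (odd), without any further argument.  It remains to compare the
  parity of \<open>\<psi>\<close> with that of \<open>\<phi>\<close>, and both are treated at once as the equation
  \<open>f(-x, y) = s f(x, y)\<close>, with \<open>s = 1\<close> or \<open>s = -1\<close>.

  For both functions this equation amounts to \<open>(-1)\<^sup>n a\<^sub>n(y) = s a\<^sub>n(y)\<close> for all \<open>n\<close> and all
  \<open>(0, y) \<in> D\<close>: the factors \<open>\<i>\<^sup>n\<close>, being nonzero, do not affect which coefficients vanish.
  For \<open>\<psi>\<close> the equivalence holds on all of \<open>U\<close>, where \<open>\<psi>\<close> is the sum of its series.
  For \<open>\<phi>\<close> the series only gives the equation near the line \<open>x = 0\<close>.  But
  \<open>\<phi>(-x, y) - s \<phi>(x, y)\<close> is real analytic on the connected open set \<open>D\<close>, which meets this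
  line, so the identity theorem for real analytic functions of two variables
  (\<open>real_analytic_identity\<close>) carries the equation to all of \<open>D\<close>.
\<close>

section \<open>The identity theorem for real analytic functions of two variables\<close>

text \<open>
  The series extends to a holomorphic function on the complex disc, whose zeros accumulate at
  \<open>x\<^sub>0\<close>, so analytic continuation applies.  The coefficients are complex for the sake of Wick
  rotations; the interval need not be centred at \<open>0\<close>, so that zeros can be propagated through
  the region of convergence from any place where they are known.
\<close>

lemma power_series_zero_on_interval:
  fixes A :: "nat \<Rightarrow> complex"
  assumes A: "\<And>x. \<bar>x\<bar> < r \<Longrightarrow> summable (\<lambda>n. A n * of_real x ^ n)"
    and x0: "\<bar>x0\<bar> < r" and e: "e > 0"
    and zero: "\<And>x. \<bar>x - x0\<bar> < e \<Longrightarrow> \<bar>x\<bar> < r \<Longrightarrow> (\<lambda>n. A n * of_real x ^ n) sums 0"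
  shows "A n = 0"
proof -
  have r: "r > 0" using x0 by linarith
  have rad: "ereal r \<le> fps_conv_radius (Abs_fps A)"
    unfolding fps_conv_radius_def
  proof (rule conv_radius_geI_ex')
    fix s :: real assume "0 < s" "ereal s < ereal r"
    then show "summable (\<lambda>n. fps_nth (Abs_fps A) n * of_real s ^ n)"
      using A[of s] by simp
  qed
  define V where "V = complex_of_real ` {x. \<bar>x - x0\<bar> < e \<and> \<bar>x\<bar> < r}"
  have lim: "complex_of_real x0 islimpt V"
    unfolding islimpt_approachable
  proof (intro allI impI)
    fix d :: real assume d: "d > 0"
    \<comment> \<open>A step to the right that stays in the three intervals involved, of radii \<open>d\<close>, \<open>e\<close> and \<open>r\<close>.\<close>
    define h where "h = min (min d e) (r - \<bar>x0\<bar>) / 2"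
    have h: "h > 0" "h < d" "h < e" "h < r - \<bar>x0\<bar>"
      using d e x0 by (auto simp: h_def min_def)
    then have "complex_of_real (x0 + h) \<in> V"
      unfolding V_def by (intro imageI) auto
    moreover have "dist (complex_of_real (x0 + h)) (of_real x0) < d"
      using h by (simp add: dist_norm)
    ultimately show "\<exists>z\<in>V. z \<noteq> complex_of_real x0 \<and> dist z (of_real x0) < d"
      using h by (intro bexI[of _ "complex_of_real (x0 + h)"]) auto
  qed
  have z: "eval_fps (Abs_fps A) w = 0" if w: "w \<in> ball 0 r" for w
  proof (rule analytic_continuation[OF _ open_ball _ _ _ lim _ w])
    show "eval_fps (Abs_fps A) holomorphic_on ball 0 r"
    proof (rule holomorphic_on_eval_fps)
      show "ball (0 :: complex) r \<subseteq> eball 0 (fps_conv_radius (Abs_fps A))"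
        using rad by (rule ball_eball_mono)
    qed
    show "eval_fps (Abs_fps A) z = 0" if "z \<in> V" for z
      using that zero by (auto simp: V_def eval_fps_def sums_iff)
  qed (use x0 in \<open>auto simp: V_def\<close>)
  have "(\<lambda>_. 0) has_fps_expansion Abs_fps A"
    unfolding has_fps_expansion_def
  proof
    show "0 < fps_conv_radius (Abs_fps A)"
      using rad r by (simp add: order.strict_trans2[of 0 "ereal r"])
    have "eventually (\<lambda>w. w \<in> ball 0 r) (nhds (0 :: complex))"
      using r by (intro eventually_nhds_in_open) auto
    then show "\<forall>\<^sub>F w in nhds 0. eval_fps (Abs_fps A) w = 0"
      by eventually_elim (rule z)
  qed
  from fps_nth_fps_expansion[OF this, of n] fps_nth_fps_expansion[OF has_fps_expansion_0, of n]
  show ?thesis by simp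
qed

lemma real_power_series_identity:
  fixes A :: "nat \<Rightarrow> real"
  assumes A: "\<And>x. \<bar>x\<bar> < r \<Longrightarrow> (\<lambda>n. A n * x ^ n) sums f x"
    and x0: "\<bar>x0\<bar> < r" and e: "e > 0" and zero: "\<And>x. \<bar>x - x0\<bar> < e \<Longrightarrow> \<bar>x\<bar> < r \<Longrightarrow> f x = 0"
    and x: "\<bar>x\<bar> < r"
  shows "f x = 0"
proof -
  have sums: "(\<lambda>n. complex_of_real (A n) * of_real x ^ n) sums of_real (f x)" if "\<bar>x\<bar> < r" for x
    using sums_of_real[OF A[OF that], where 'a = complex] by simp
  have "complex_of_real (A n) = 0" for n
    by (rule power_series_zero_on_interval[OF _ x0 e])
      (use sums zero in \<open>force simp: sums_iff\<close>)+
  then show ?thesis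
    using A[OF x] by (simp add: sums_iff)
qed

text \<open>
  Moving parallel to the axes suffices to cross a box, so that no re-expansion of the double series
  at another centre is needed: horizontal slices extend the zeros from a small box to a strip of
  full width, vertical ones from the strip to the whole box.
\<close>

lemma double_power_series_identity:
  fixes f :: "real \<times> real \<Rightarrow> real"
  assumes c: "\<And>x y. \<bar>x\<bar> < r \<Longrightarrow> \<bar>y\<bar> < r \<Longrightarrow>
      ((\<lambda>(m, n). c m n * x ^ m * y ^ n) has_sum f (x, y)) UNIV"
    and x0: "\<bar>x0\<bar> < r" and y0: "\<bar>y0\<bar> < r" and e: "e > 0"
    and zero: "\<And>x y. \<bar>x - x0\<bar> < e \<Longrightarrow> \<bar>y - y0\<bar> < e \<Longrightarrow> f (x, y) = 0"
    and x: "\<bar>x\<bar> < r" and y: "\<bar>y\<bar> < r"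
  shows "f (x, y) = 0"
proof -
  have r: "r > 0" using x by linarith
  have swapped: "((\<lambda>(m, n). c n m * y ^ m * (x - 0) ^ n) has_sum (f \<circ> prod.swap) (y, x)) UNIV"
    if "\<bar>y\<bar> < r" "\<bar>x - 0\<bar> < r" for x y
    using c[of x y] that has_sum_swap[of "\<lambda>(m, n). c m n * x ^ m * y ^ n" UNIV UNIV "f (x, y)"]
    by (simp add: mult_ac case_prod_unfold)
  have strip: "f (x, y) = 0" if x: "\<bar>x\<bar> < r" and y: "\<bar>y\<bar> < r" and "\<bar>y - y0\<bar> < e" for x y
  proof -
    obtain A where "\<And>x. \<bar>x\<bar> < r \<Longrightarrow> (\<lambda>m. A m * x ^ m) sums f (x, y)"
      using real_analytic_on_slice[of r 0 c f y] c r y by auto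
    then show ?thesis
      by (rule real_power_series_identity[OF _ x0 e _ x]) (use zero that in auto)
  qed
  obtain B where "\<And>y. \<bar>y\<bar> < r \<Longrightarrow> (\<lambda>m. B m * y ^ m) sums (f \<circ> prod.swap) (y, x)"
    using real_analytic_on_slice[OF swapped r, of x] x by auto
  then have "(f \<circ> prod.swap) (y, x) = 0"
    by (rule real_power_series_identity[OF _ y0 e _ y]) (use strip x in auto)
  then show ?thesis by simp
qed

lemma box_around:
  assumes "open S" and "(a, b) \<in> S"
  obtains e :: real where "e > 0" and "\<And>x y. \<bar>x - a\<bar> < e \<Longrightarrow> \<bar>y - b\<bar> < e \<Longrightarrow> (x, y) \<in> S"
proof -
  obtain A B where AB: "open A" "open B" "(a, b) \<in> A \<times> B" "A \<times> B \<subseteq> S"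
    using open_prod_elim[OF assms] by metis
  obtain d1 where d1: "d1 > 0" "\<And>x. \<bar>x - a\<bar> < d1 \<Longrightarrow> x \<in> A"
    using AB(1,3) unfolding open_real by auto
  obtain d2 where d2: "d2 > 0" "\<And>x. \<bar>x - b\<bar> < d2 \<Longrightarrow> x \<in> B"
    using AB(2,3) unfolding open_real by auto
  show ?thesis
    by (rule that[of "min d1 d2"]) (use d1 d2 AB(4) in auto)
qed

text \<open>
  Vanishing in a neighbourhood of a point, unlike vanishing at the point, spreads over every box on
  which a double series represents \<open>f\<close>; since these boxes cover the connected set \<open>D\<close>,
  it spreads over \<open>D\<close>.
\<close>

theorem real_analytic_identity:
  assumes "connected D" and f: "real_analytic_on D f"
    and p: "p \<in> D" and zero: "\<forall>\<^sub>F u in nhds p. f u = 0" and q: "q \<in> D"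
  shows "f q = 0"
proof -
  have "\<forall>\<^sub>F u in nhds q. f u = 0"
  proof (rule connected_induction_simple[OF \<open>connected D\<close> p q, where P = "\<lambda>v. \<forall>\<^sub>F u in nhds v. f u = 0"])
    show "\<forall>\<^sub>F u in nhds p. f u = 0" by (rule zero)
  next
    fix v assume v: "v \<in> D"
    obtain a b where ab: "v = (a, b)" by (cases v)
    obtain r c where r: "r > 0" and c: "\<And>x y. \<bar>x - a\<bar> < r \<Longrightarrow> \<bar>y - b\<bar> < r \<Longrightarrow>
        ((\<lambda>(m, n). c m n * (x - a) ^ m * (y - b) ^ n) has_sum f (x, y)) UNIV"
      using f v unfolding real_analytic_on_def ab by blast
    define g where "g = (\<lambda>(x, y). f (x + a, y + b))"
    have g: "((\<lambda>(m, n). c m n * x ^ m * y ^ n) has_sum g (x, y)) UNIV"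
      if "\<bar>x\<bar> < r" "\<bar>y\<bar> < r" for x y
      using c[of "x + a" "y + b"] that by (simp add: g_def)
    define Box where "Box = {a - r<..<a + r} \<times> {b - r<..<b + r}"
    have Box: "open Box" unfolding Box_def by (intro open_Times) auto
    have spread: "\<forall>\<^sub>F u in nhds w'. f u = 0"
      if w: "w \<in> Box" and w': "w' \<in> Box" and ev: "\<forall>\<^sub>F u in nhds w. f u = 0" for w w'
    proof -
      obtain x0 y0 where xy0: "w = (x0, y0)" by (cases w)
      obtain S where S: "open S" "(x0, y0) \<in> S" "\<And>u. u \<in> S \<Longrightarrow> f u = 0"
        using ev unfolding eventually_nhds xy0 by blast
      obtain e where e: "e > 0" "\<And>x y. \<bar>x - x0\<bar> < e \<Longrightarrow> \<bar>y - y0\<bar> < e \<Longrightarrow> (x, y) \<in> S"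
        using box_around[OF S(1,2)] by blast
      have "f u = 0" if "u \<in> Box" for u
      proof -
        obtain x y where u: "u = (x, y)" by (cases u)
        have "g (x - a, y - b) = 0"
        proof (rule double_power_series_identity[of r c g "x0 - a" "y0 - b" e])
          show "g (x', y') = 0" if "\<bar>x' - (x0 - a)\<bar> < e" "\<bar>y' - (y0 - b)\<bar> < e" for x' y'
            using that unfolding g_def by (auto intro!: S e simp: algebra_simps)
        qed (use w that e g in \<open>auto simp: Box_def xy0 u\<close>)
        then show ?thesis by (simp add: g_def u)
      qed
      with Box w' show ?thesis unfolding eventually_nhds by blast
    qed
    show "\<exists>T. openin (top_of_set D) T \<and> v \<in> T \<and> (\<forall>x\<in>T. \<forall>y\<in>T.
        (\<forall>\<^sub>F u in nhds x. f u = 0) \<longrightarrow> (\<forall>\<^sub>F u in nhds y. f u = 0))"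
    proof (intro exI conjI ballI impI)
      show "openin (top_of_set D) (D \<inter> Box)" using Box by (rule openin_open_Int)
      show "v \<in> D \<inter> Box" using v r by (simp add: Box_def ab)
    qed (use spread in blast)
  qed
  then show ?thesis by (rule eventually_nhds_x_imp_x)
qed

section \<open>Reflection in the first variable\<close>

text \<open>
  The expansion of \<open>f(-x, y)\<close> at \<open>(a, b)\<close> comes from that of \<open>f\<close> at the mirror point
  \<open>(-a, b)\<close>, the coefficients changing by \<open>(-1)\<^sup>m\<close>.
\<close>

lemma real_analytic_on_reflection_defect:
  assumes sym: "symmetric_x1 D" and f: "real_analytic_on D f"
  shows "real_analytic_on D (\<lambda>(x, y). f (- x, y) - s * f (x, y))"
  unfolding real_analytic_on_def
proof clarify
  fix a b assume ab: "(a, b) \<in> D"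
  then have ab': "(- a, b) \<in> D" using sym by (auto simp: symmetric_x1_def)
  obtain r c where r: "r > 0" and c: "\<And>x y. \<bar>x - a\<bar> < r \<Longrightarrow> \<bar>y - b\<bar> < r \<Longrightarrow>
      ((\<lambda>(m, n). c m n * (x - a) ^ m * (y - b) ^ n) has_sum f (x, y)) UNIV"
    using f ab unfolding real_analytic_on_def by blast
  obtain r' c' where r': "r' > 0" and c': "\<And>x y. \<bar>x - - a\<bar> < r' \<Longrightarrow> \<bar>y - b\<bar> < r' \<Longrightarrow>
      ((\<lambda>(m, n). c' m n * (x - - a) ^ m * (y - b) ^ n) has_sum f (x, y)) UNIV"
    using f ab' unfolding real_analytic_on_def by blast
  show "\<exists>r>0. \<exists>c. \<forall>x y. \<bar>x - a\<bar> < r \<longrightarrow> \<bar>y - b\<bar> < r \<longrightarrow>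
      ((\<lambda>(m, n). c m n * (x - a) ^ m * (y - b) ^ n) has_sum f (- x, y) - s * f (x, y)) UNIV"
  proof (intro exI[of _ "min r r'"] conjI exI[of _ "\<lambda>m n. (- 1) ^ m * c' m n - s * c m n"] allI impI)
    fix x y assume x: "\<bar>x - a\<bar> < min r r'" and y: "\<bar>y - b\<bar> < min r r'"
    have flip: "(a - x) ^ m = (- 1) ^ m * (x - a) ^ m" for m
      by (simp flip: power_mult_distrib)
    have "((\<lambda>(m, n). (- 1) ^ m * c' m n * (x - a) ^ m * (y - b) ^ n) has_sum f (- x, y)) UNIV"
      using c'[of "- x" y] x y by (simp add: flip mult_ac abs_minus_commute)
    moreover have "((\<lambda>(m, n). - s * (c m n * (x - a) ^ m * (y - b) ^ n))
        has_sum - s * f (x, y)) UNIV"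
      using has_sum_cmult_right[OF c[of x y], of "- s"] x y by (simp add: case_prod_unfold)
    ultimately show "((\<lambda>(m, n). ((- 1) ^ m * c' m n - s * c m n) * (x - a) ^ m * (y - b) ^ n)
        has_sum f (- x, y) - s * f (x, y)) UNIV"
      using has_sum_add by (fastforce simp: case_prod_unfold algebra_simps)
  qed (use r r' in auto)
qed

lemma taylor_x1_sums:
  assumes f: "real_analytic_on D f" and b: "(0, b) \<in> D"
  obtains r where "r > 0"
    "\<And>x y. \<bar>x\<bar> < r \<Longrightarrow> \<bar>y - b\<bar> < r \<Longrightarrow> (\<lambda>n. taylor_x1 f n y * x ^ n) sums f (x, y)"
proof -
  obtain r c where r: "r > 0" and c: "\<And>x y. \<bar>x - 0\<bar> < r \<Longrightarrow> \<bar>y - b\<bar> < r \<Longrightarrow>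
      ((\<lambda>(m, n). c m n * (x - 0) ^ m * (y - b) ^ n) has_sum f (x, y)) UNIV"
    using f b unfolding real_analytic_on_def by blast
  show ?thesis
  proof (rule that[OF r])
    fix x y assume x: "\<bar>x\<bar> < r" and y: "\<bar>y - b\<bar> < r"
    obtain A where A: "\<And>x. \<bar>x\<bar> < r \<Longrightarrow> (\<lambda>m. A m * x ^ m) sums f (x, y)"
      using real_analytic_on_slice[of r b c f y] c r y by auto
    then show "(\<lambda>n. taylor_x1 f n y * x ^ n) sums f (x, y)"
      using taylor_x1_power_series(1)[OF r, of A f y] x by simp
  qed
qed

text \<open>
  Both parities are handled together, \<open>s = 1\<close> being the even and \<open>s = -1\<close> the odd case;
  the coefficient condition then says that \<open>a\<^sub>n = 0\<close> for all odd, respectively all even, \<open>n\<close>.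
  From coefficients to function, the Taylor series only reach a neighbourhood of a point
  \<open>(0, b) \<in> D\<close>, and the identity theorem does the rest.
\<close>

lemma reflection_iff_taylor_x1:
  assumes D: "open D" "connected D" "symmetric_x1 D" "D \<inter> x1_zero_set \<noteq> {}"
    and f: "real_analytic_on D f"
  shows "(\<forall>(x, y)\<in>D. f (- x, y) = s * f (x, y)) \<longleftrightarrow>
    (\<forall>y n. (0, y) \<in> D \<longrightarrow> (- 1) ^ n * taylor_x1 f n y = s * taylor_x1 f n y)" (is "?L \<longleftrightarrow> ?R")
proof
  assume L: ?L
  show ?R
  proof (intro allI impI)
    fix y n assume y: "(0, y) \<in> D"
    obtain e where e: "e > 0" "\<And>x y'. \<bar>x - 0\<bar> < e \<Longrightarrow> \<bar>y' - y\<bar> < e \<Longrightarrow> (x, y') \<in> D"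
      using box_around[OF D(1) y] by blast
    obtain r where r: "r > 0"
      and sums: "\<And>x y'. \<bar>x\<bar> < r \<Longrightarrow> \<bar>y' - y\<bar> < r \<Longrightarrow> (\<lambda>n. taylor_x1 f n y' * x ^ n) sums f (x, y')"
      using taylor_x1_sums[OF f y] by blast
    define A where "A n = (- 1) ^ n * taylor_x1 f n y - s * taylor_x1 f n y" for n
    have A: "(\<lambda>n. complex_of_real (A n) * of_real x ^ n) sums 0" if "\<bar>x\<bar> < min e r" for x
    proof -
      have "(\<lambda>n. taylor_x1 f n y * (- x) ^ n - s * (taylor_x1 f n y * x ^ n))
          sums (f (- x, y) - s * f (x, y))"
        using sums[of x y] sums[of "- x" y] that r by (intro sums_diff sums_mult) auto
      moreover have "f (- x, y) = s * f (x, y)" using L e(2)[of x y] e(1) that by auto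
      moreover have "taylor_x1 f n y * (- x) ^ n - s * (taylor_x1 f n y * x ^ n) = A n * x ^ n" for n
        unfolding A_def by (subst power_minus) (simp add: algebra_simps)
      ultimately have "(\<lambda>n. A n * x ^ n) sums 0" by simp
      from sums_of_real[OF this, where 'a = complex] show ?thesis by simp
    qed
    have "complex_of_real (A n) = 0"
      by (rule power_series_zero_on_interval[of "min e r" _ 0 1])
        (use A e r in \<open>auto simp: sums_iff\<close>)
    then have "A n = 0" by (simp only: of_real_eq_0_iff)
    then show "(- 1) ^ n * taylor_x1 f n y = s * taylor_x1 f n y" by (simp add: A_def)
  qed
next
  assume R: ?R
  define g where "g = (\<lambda>(x, y). f (- x, y) - s * f (x, y))"
  obtain b where b: "(0, b) \<in> D" using D(4) by (auto simp: x1_zero_set_def)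
  obtain e where e: "e > 0" "\<And>x y. \<bar>x - 0\<bar> < e \<Longrightarrow> \<bar>y - b\<bar> < e \<Longrightarrow> (x, y) \<in> D"
    using box_around[OF D(1) b] by blast
  obtain r where r: "r > 0"
    and sums: "\<And>x y. \<bar>x\<bar> < r \<Longrightarrow> \<bar>y - b\<bar> < r \<Longrightarrow> (\<lambda>n. taylor_x1 f n y * x ^ n) sums f (x, y)"
    using taylor_x1_sums[OF f b] by blast
  have near: "g (x, y) = 0" if x: "\<bar>x\<bar> < min e r" and y: "\<bar>y - b\<bar> < min e r" for x y
  proof -
    have "(0, y) \<in> D" using e y by simp
    then have "taylor_x1 f n y * (- x) ^ n = s * (taylor_x1 f n y * x ^ n)" for n
      using R by (subst power_minus) (simp add: mult_ac)
    moreover have "(\<lambda>n. taylor_x1 f n y * (- x) ^ n) sums f (- x, y)"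
      using sums[of "- x" y] x y by simp
    ultimately have "(\<lambda>n. s * (taylor_x1 f n y * x ^ n)) sums f (- x, y)"
      by (simp only:)
    moreover have "(\<lambda>n. s * (taylor_x1 f n y * x ^ n)) sums (s * f (x, y))"
      using sums[of x y] x y by (intro sums_mult) auto
    ultimately show ?thesis by (simp add: g_def sums_unique2)
  qed
  have "\<forall>\<^sub>F u in nhds (0, b). g u = 0"
    unfolding eventually_nhds
  proof (intro exI conjI ballI)
    let ?S = "{- min e r<..<min e r} \<times> {b - min e r<..<b + min e r}"
    show "open ?S" by (intro open_Times) auto
    show "(0, b) \<in> ?S" using e r by auto
    show "g u = 0" if "u \<in> ?S" for u
      using that by (cases u) (auto intro!: near)
  qed
  then have "g u = 0" if "u \<in> D" for u
    using real_analytic_identity[OF D(2) _ b _ that]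
      real_analytic_on_reflection_defect[OF D(3) f, of s] by (simp add: g_def)
  then show ?L by (force simp: g_def)
qed

section \<open>Wick rotation\<close>

lemma wick_sums:
  assumes "(x, y) \<in> wick_domain D f"
  shows "(\<lambda>n. of_real (taylor_x1 f n y) * (\<i> * of_real x) ^ n) sums wick f (x, y)"
proof -
  have "ereal (norm \<bar>x\<bar>) < conv_radius (\<lambda>n. taylor_x1 f n y)"
    using assms by (simp add: wick_domain_def)
  then have "summable (\<lambda>n. norm (taylor_x1 f n y * \<bar>x\<bar> ^ n))"
    by (rule abs_summable_in_conv_radius)
  then have "summable (\<lambda>n. norm (of_real (taylor_x1 f n y) * (\<i> * of_real x) ^ n))"
    by (simp add: norm_mult norm_power abs_mult power_abs)
  then show ?thesis
    by (simp add: wick_def summable_norm_cancel summable_sums)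
qed

lemma cnj_wick:
  assumes "(x, y) \<in> wick_domain D f"
  shows "cnj (wick f (x, y)) = wick f (- x, y)"
proof -
  have "(- x, y) \<in> wick_domain D f" using assms by (simp add: wick_domain_def)
  from wick_sums[OF this]
  have "(\<lambda>n. cnj (of_real (taylor_x1 f n y) * (\<i> * of_real x) ^ n)) sums wick f (- x, y)"
    by simp
  moreover have "(\<lambda>n. cnj (of_real (taylor_x1 f n y) * (\<i> * of_real x) ^ n))
      sums cnj (wick f (x, y))"
    using wick_sums[OF assms] by (simp only: sums_cnj)
  ultimately show ?thesis by (simp add: sums_unique2)
qed

text \<open>
  The equivalence holds on each line \<open>y = const\<close> separately: every point of \<open>U\<close> lies within the
  radius of convergence of the series at a point \<open>(0, y) \<in> D\<close>, and conversely \<open>U\<close>, being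
  open, contains an interval around each such point, which determines the coefficients.
\<close>

lemma wick_reflection_iff_taylor_x1:
  fixes s :: real
  assumes "open U" and "D \<inter> x1_zero_set \<subseteq> U" and U: "U \<subseteq> wick_domain D f"
  shows "(\<forall>(x, y)\<in>U. wick f (- x, y) = of_real s * wick f (x, y)) \<longleftrightarrow>
    (\<forall>y n. (0, y) \<in> D \<longrightarrow> (- 1) ^ n * taylor_x1 f n y = s * taylor_x1 f n y)" (is "?L \<longleftrightarrow> ?R")
proof -
  define A where "A y n = (- 1) ^ n * taylor_x1 f n y - s * taylor_x1 f n y" for y n
  have A: "(\<lambda>n. of_real (A y n) * \<i> ^ n * of_real x ^ n)
      sums (wick f (- x, y) - of_real s * wick f (x, y))" if "(x, y) \<in> U" for x y
  proof -
    have xy: "(x, y) \<in> wick_domain D f" using U that by blast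
    then have xy': "(- x, y) \<in> wick_domain D f" by (simp add: wick_domain_def)
    have flip: "(\<i> * of_real (- x)) ^ n = (- 1) ^ n * (\<i> * of_real x) ^ n" for n
      by (simp flip: power_mult_distrib)
    have "(\<lambda>n. of_real (taylor_x1 f n y) * (\<i> * of_real (- x)) ^ n
          - of_real s * (of_real (taylor_x1 f n y) * (\<i> * of_real x) ^ n))
        sums (wick f (- x, y) - of_real s * wick f (x, y))"
      by (intro sums_diff sums_mult wick_sums[OF xy] wick_sums[OF xy'])
    then show ?thesis
      unfolding flip A_def by (simp add: algebra_simps)
  qed
  show ?thesis
  proof
    assume L: ?L
    show ?R
    proof (intro allI impI)
      fix y n assume "(0, y) \<in> D"
      then have "(0, y) \<in> U" using assms(2) by (auto simp: x1_zero_set_def)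
      then obtain e where e: "e > 0" "\<And>x y'. \<bar>x - 0\<bar> < e \<Longrightarrow> \<bar>y' - y\<bar> < e \<Longrightarrow> (x, y') \<in> U"
        using box_around[OF assms(1)] by blast
      have "(\<lambda>n. of_real (A y n) * \<i> ^ n * of_real x ^ n) sums 0" if "\<bar>x\<bar> < e" for x
      proof -
        have "(x, y) \<in> U" using e that by simp
        with A[of x y] L show ?thesis by auto
      qed
      then have "of_real (A y n) * \<i> ^ n = 0"
        by (intro power_series_zero_on_interval[of e _ 0 1]) (use e in \<open>auto simp: sums_iff\<close>)
      then have "A y n = 0" by simp
      then show "(- 1) ^ n * taylor_x1 f n y = s * taylor_x1 f n y" by (simp add: A_def)
    qed
  next
    assume R: ?R
    show ?L
    proof clarify
      fix x y assume xy: "(x, y) \<in> U"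
      then have "(0, y) \<in> D" using U by (auto simp: wick_domain_def)
      then have "A y n = 0" for n using R by (simp add: A_def)
      then show "wick f (- x, y) = of_real s * wick f (x, y)"
        using A[OF xy] by (simp add: sums_iff)
    qed
  qed
qed

theorem lemma3p1:
  fixes \<phi> :: "real \<times> real \<Rightarrow> real" and D U :: "(real \<times> real) set"
  assumes "open D" and "connected D" and "symmetric_x1 D" and "D \<inter> x1_zero_set \<noteq> {}"
    and "real_analytic_on D \<phi>"
    and "open U" and "symmetric_x1 U" and "D \<inter> x1_zero_set \<subseteq> U" and "U \<subseteq> wick_domain D \<phi>"
  shows "((\<forall>p\<in>U. wick \<phi> p \<in> \<real>) \<longleftrightarrow> even_x1_on D \<phi>)
       \<and> ((\<forall>p\<in>U. Re (wick \<phi> p) = 0) \<longleftrightarrow> odd_x1_on D \<phi>)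
       \<and> ((\<forall>p\<in>U. wick \<phi> p \<in> \<real>) \<longrightarrow> even_x1_on U (wick \<phi>))
       \<and> ((\<forall>p\<in>U. Re (wick \<phi> p) = 0) \<longrightarrow> odd_x1_on U (wick \<phi>))"
proof -
  have parity: "(\<forall>(x, y)\<in>U. wick \<phi> (- x, y) = of_real s * wick \<phi> (x, y)) \<longleftrightarrow>
      (\<forall>(x, y)\<in>D. \<phi> (- x, y) = s * \<phi> (x, y))" for s
    using reflection_iff_taylor_x1[OF assms(1-5), of s]
      wick_reflection_iff_taylor_x1[OF assms(6,8,9), of s] by simp
  have cnj: "cnj (wick \<phi> (x, y)) = wick \<phi> (- x, y)" if "(x, y) \<in> U" for x y
    using cnj_wick assms(9) that by blast
  have real: "(\<forall>p\<in>U. wick \<phi> p \<in> \<real>) \<longleftrightarrow> even_x1_on U (wick \<phi>)"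
    unfolding even_x1_on_def Reals_cnj_iff using cnj by fastforce
  have imag: "(\<forall>p\<in>U. Re (wick \<phi> p) = 0) \<longleftrightarrow> odd_x1_on U (wick \<phi>)"
  proof -
    have "Re z = 0 \<longleftrightarrow> cnj z = - z" for z by (auto simp: complex_eq_iff)
    then show ?thesis unfolding odd_x1_on_def using cnj by fastforce
  qed
  have "even_x1_on U (wick \<phi>) \<longleftrightarrow> even_x1_on D \<phi>"
    using parity[of 1] by (simp add: even_x1_on_def)
  moreover have "odd_x1_on U (wick \<phi>) \<longleftrightarrow> odd_x1_on D \<phi>"
    using parity[of "- 1"] by (simp add: odd_x1_on_def)
  ultimately show ?thesis using real imag by simp
qed

end
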